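(* Consider a spherical code on $\mathbb{S}^{n-1}$ obtained as a spectral embedding of a strongly regular graph with parameters $(v,k,\lambda,\mu)$, with inner products $p$ and $q$, where $-1<p<0<q<1$, and suppose $p+q\le0$. Then this code is universally optimal among the codes with scalar products in $[p,1]$ (i.e. among $[-1,p)$-avoiding codes). Namely, for every absolutely monotone $h$: if $p$ corresponds to an edge, then $$E_h(C)\ \ge\ \mathcal{E}_h(n,v;[-1,p))=v\,k\,h(p)+v\,(v-k-1)\,h(q)$$ for every $[-1,p)$-avoiding code $C\subset\mathbb{S}^{n-1}$ with $|C|=v$; otherwise, $p$ corresponds to a non-edge and $$E_h(C)\ \ge\ \mathcal{E}_h(n,v;[-1,p))=v\,(v-k-1)\,h(p)+v\,k\,h(q)$$ for every $[-1,p)$-avoiding code $C\subset\mathbb{S}^{n-1}$ with $|C|=v$.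
   Context: A spherical code is a finite set $C\subset\mathbb{S}^{n-1}$; $I(C)=\{x\cdot y: x,y\in C,\ x\ne y\}$. For $T\subset[-1,1)$, $C$ is $T$-avoiding if $I(C)\cap T=\varnothing$. A potential is a function $h:[-1,1)\to(-\infty,+\infty)$, continuous on $[-1,1)$; it is absolutely monotone if $h^{(j)}\ge0$ for all $j\ge1$ (on $(-1,1)$). The $h$-energy is $E_h(C)=\sum_{x\neq y\in C}h(x\cdot y)$ (sum over ordered pairs). $\mathcal{E}_h(n,N;T)$ is the minimum of $E_h(C)$ over all $T$-avoiding spherical codes $C\subset\mathbb{S}^{n-1}$ with $|C|=N$. A code is universally optimal in a class of codes if for every absolutely monotone $h$ it minimizes $E_h$ among the codes in the class having its cardinality. A strongly regular graph (SRG) with parameters $(v,k,\lambda,\mu)$ is a graph with $v$ vertices, every vertex of degree $k$, every two adjacent vertices having exactly $\lambda$ common neighbors and every two distinct non-adjacent vertices having exactly $\mu$ common neighbors. Its adjacency matrix has three eigenvalues $k$, $e_1$, $e_2$ with $e_1\ge0>e_2$ and multiplicities $1,n_1,n_2$, $n_1+n_2=v-1$. For $i\in\{1,2\}$, the spectral embedding into $\mathbb{S}^{n-1}$, $n=n_i$, is obtained by orthogonally projecting the standard basis vectors of $\mathbb{R}^v$ (indexed by vertices) onto the $e_i$-eigenspace and rescaling to unit length; it is a $v$-point spherical $2$-design in which the inner product of the images of two distinct vertices depends only on whether they are adjacent: it equals $e_i/k$ for adjacent vertices and $-(1+e_i)/(v-k-1)$ for non-adjacent ones. The smaller of these two inner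 products is denoted $p$ and the larger $q$. "$p$ corresponds to an edge" means that $p$ is the inner product of the images of adjacent vertices; "to a non-edge" means that of distinct non-adjacent vertices. *)

theory Defs
  imports "HOL-Analysis.Analysis"
begin

definition spherical_code :: "'a::euclidean_space set \<Rightarrow> bool" where
  "spherical_code C \<longleftrightarrow> finite C \<and> C \<subseteq> sphere 0 1"

definition inner_products :: "'a::euclidean_space set \<Rightarrow> real set" where
  "inner_products C = {x \<bullet> y | x y. x \<in> C \<and> y \<in> C \<and> x \<noteq> y}"

definition avoiding_codes :: "real set \<Rightarrow> 'a::euclidean_space set set" where
  "avoiding_codes T = {C. spherical_code C \<and> inner_products C \<inter> T = {}}"

text \<open>A potential on \<open>[-1,1)\<close> is a total function of which only the values on \<open>[-1,1)\<close>
  matter. Since \<open>(-1,1)\<close> is open, the iterated derivatives there do not depend on the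
  values outside.\<close>

definition absolutely_monotone :: "(real \<Rightarrow> real) \<Rightarrow> bool" where
  "absolutely_monotone h \<longleftrightarrow>
     continuous_on {-1..<1} h \<and>
     (\<forall>j. \<forall>t\<in>{-1<..<1}. (deriv ^^ j) h differentiable (at t)) \<and>
     (\<forall>j\<ge>1. \<forall>t\<in>{-1<..<1}. 0 \<le> (deriv ^^ j) h t)"

definition energy :: "(real \<Rightarrow> real) \<Rightarrow> 'a::euclidean_space set \<Rightarrow> real" where
  "energy h C = (\<Sum>(x, y)\<in>{(x, y) \<in> C \<times> C. x \<noteq> y}. h (x \<bullet> y))"

text \<open>The type argument fixes the ambient space: \<open>min_energy TYPE(real ^ 'n) h N T\<close> is the
  minimum over codes on the unit sphere of dimension \<open>CARD('n) - 1\<close>.\<close>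

definition min_energy ::
    "'a::euclidean_space itself \<Rightarrow> (real \<Rightarrow> real) \<Rightarrow> nat \<Rightarrow> real set \<Rightarrow> real" where
  "min_energy _ h N T =
     (LEAST m. \<exists>C :: 'a set. C \<in> avoiding_codes T \<and> card C = N \<and> m = energy h C)"

definition universally_optimal_in ::
    "'a::euclidean_space set set \<Rightarrow> 'a set \<Rightarrow> bool" where
  "universally_optimal_in K C \<longleftrightarrow> C \<in> K \<and>
     (\<forall>h. absolutely_monotone h \<longrightarrow>
        (\<forall>D\<in>K. card D = card C \<longrightarrow> energy h C \<le> energy h D))"

text \<open>A graph is given by its adjacency relation on a finite vertex type.\<close>

definition strongly_regular_graph ::
    "('v::finite \<Rightarrow> 'v \<Rightarrow> bool) \<Rightarrow> nat \<Rightarrow> nat \<Rightarrow> nat \<Rightarrow> nat \<Rightarrow> bool" where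
  "strongly_regular_graph adj v k l m \<longleftrightarrow>
     symp adj \<and> irreflp adj \<and>
     CARD('v) = v \<and>
     (\<forall>x. card {y. adj x y} = k) \<and>
     (\<forall>x y. adj x y \<longrightarrow> card {z. adj x z \<and> adj y z} = l) \<and>
     (\<forall>x y. x \<noteq> y \<and> \<not> adj x y \<longrightarrow> card {z. adj x z \<and> adj y z} = m)"

definition adjacency_matrix :: "('v::finite \<Rightarrow> 'v \<Rightarrow> bool) \<Rightarrow> real ^ 'v ^ 'v" where
  "adjacency_matrix adj = (\<chi> x y. if adj x y then 1 else 0)"

definition eigenspace :: "real ^ 'v ^ 'v \<Rightarrow> real \<Rightarrow> (real ^ 'v) set" where
  "eigenspace A e = {x. A *v x = e *\<^sub>R x}"

definition eigenvalue :: "real ^ 'v ^ 'v \<Rightarrow> real \<Rightarrow> bool" where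
  "eigenvalue A e \<longleftrightarrow> (\<exists>x. x \<noteq> 0 \<and> A *v x = e *\<^sub>R x)"

definition orthogonal_projection :: "'a::euclidean_space set \<Rightarrow> 'a \<Rightarrow> 'a" where
  "orthogonal_projection S x = (THE y. y \<in> S \<and> (\<forall>z\<in>S. orthogonal (x - y) z))"

text \<open>The eigenspace for \<open>e\<close> is identified with \<open>\<real>\<^sup>n\<close> by a linear isometry \<open>L\<close>; its existence
  forces \<open>CARD('n)\<close> to be the multiplicity of \<open>e\<close>. Here \<open>sgn u\<close> is \<open>u\<close> rescaled to unit
  length.\<close>

definition spectral_embedding ::
    "('v::finite \<Rightarrow> 'v \<Rightarrow> bool) \<Rightarrow> real \<Rightarrow> ('v \<Rightarrow> real ^ 'n) \<Rightarrow> bool" where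
  "spectral_embedding adj e f \<longleftrightarrow>
     (\<exists>L :: real ^ 'v \<Rightarrow> real ^ 'n.
        linear L \<and>
        (\<forall>u\<in>eigenspace (adjacency_matrix adj) e. norm (L u) = norm u) \<and>
        L ` eigenspace (adjacency_matrix adj) e = UNIV \<and>
        (\<forall>x. f x = L (sgn (orthogonal_projection
                             (eigenspace (adjacency_matrix adj) e) (axis x 1)))))"

definition corresponds_to_edge :: "('v \<Rightarrow> 'v \<Rightarrow> bool) \<Rightarrow> ('v \<Rightarrow> 'a::real_inner) \<Rightarrow> real \<Rightarrow> bool" where
  "corresponds_to_edge adj f s \<longleftrightarrow> (\<forall>x y. adj x y \<longrightarrow> f x \<bullet> f y = s)"

definition corresponds_to_nonedge :: "('v \<Rightarrow> 'v \<Rightarrow> bool) \<Rightarrow> ('v \<Rightarrow> 'a::real_inner) \<Rightarrow> real \<Rightarrow> bool" where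
  "corresponds_to_nonedge adj f s \<longleftrightarrow>
     (\<forall>x y. x \<noteq> y \<and> \<not> adj x y \<longrightarrow> f x \<bullet> f y = s)"

end

theory Submission
  imports Defs
begin

text \<open>Let \<open>g\<close> be the quadratic interpolating \<open>h\<close> at \<open>p\<close> and, to second order, at \<open>q\<close>. Since
  \<open>h'\<close> is convex, \<open>g \<le> h\<close> on \<open>[p,1)\<close>, and since \<open>p + q \<le> 0\<close>, the coefficients of \<open>t\<close> and \<open>t\<^sup>2\<close>
  in \<open>g\<close> are nonnegative. For a code \<open>C\<close> of \<open>N\<close> points, \<open>E\<^sub>h(C) \<ge> E\<^sub>g(C)\<close>, and the latter is bounded
  below by means of \<open>\<Sum> x \<bullet> y = |\<Sum> x|\<^sup>2 \<ge> 0\<close> and \<open>\<Sum> (x \<bullet> y)\<^sup>2 \<ge> N\<^sup>2 / n\<close>. All these inequalities are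
  equalities for the spectral embedding: its inner products are \<open>p\<close> and \<open>q\<close>, it is centred because
  the eigenvectors are orthogonal to the all-ones vector, and it is a tight frame because it is a
  rescaled projection of an orthonormal basis.\<close>

section \<open>Quadratic minorants of absolutely monotone functions\<close>

lemma absolutely_monotone_deriv:
  assumes "absolutely_monotone h" "t \<in> {-1<..<1}"
  shows "((deriv ^^ j) h has_real_derivative (deriv ^^ Suc j) h t) (at t)"
  using assms by (simp add: absolutely_monotone_def DERIV_deriv_iff_real_differentiable)

text \<open>Rolle's theorem gives a zero \<open>c\<close> of \<open>r'\<close> between
  \<open>p\<close> and \<open>q\<close>. A convex function vanishing at \<open>c\<close> and
  \<open>q\<close> is nonpositive between them and nonnegative outside. So \<open>r\<close> rises
  from 0 at \<open>p\<close> until \<open>c\<close>, falls back to 0 at \<open>q\<close>, and rises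
  again.\<close>

lemma deriv_convex_imp_nonneg:
  fixes r r' :: "real \<Rightarrow> real"
  assumes der: "\<And>t. t \<in> {-1<..<1} \<Longrightarrow> (r has_real_derivative r' t) (at t)"
    and cvx: "convex_on {-1<..<1} r'"
    and pq: "-1 < p" "p < q" "q < 1"
    and zeros: "r p = 0" "r q = 0" "r' q = 0"
    and t: "p \<le> t" "t < 1"
  shows "0 \<le> r t"
proof -
  obtain c where c: "p < c" "c < q" "r' c = 0"
    using MVT2[of p q r r'] der pq zeros by force
  note slope = convex_on_slope_le[OF cvx]
  consider "t \<le> c" | "c < t" "t \<le> q" | "q < t"
    by linarith
  then show ?thesis
  proof cases
    case 1
    have "0 \<le> r' s" if "p \<le> s" "s \<le> t" for s
    proof (cases "s = c")
      case False
      with slope(2)[of s q c] that 1 c pq zeros show ?thesis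
        by (auto simp: divide_simps split: if_splits)
    qed (use c in simp)
    then have "r p \<le> r t"
      using t 1 c pq by (intro DERIV_nonneg_imp_nondecreasing[of p t r]) (auto intro!: exI der)
    then show ?thesis
      using zeros by simp
  next
    case 2
    have "r' s \<le> 0" if "t \<le> s" "s \<le> q" for s
    proof (cases "s = q")
      case False
      with slope(1)[of c q s] that 2 c pq zeros show ?thesis
        by (auto simp: divide_simps split: if_splits)
    qed (use zeros in simp)
    then have "r t \<ge> r q"
      using t 2 c pq by (intro DERIV_nonpos_imp_nonincreasing[of t q r]) (auto intro!: exI der)
    then show ?thesis
      using zeros by simp
  next
    case 3
    have "0 \<le> r' s" if "q \<le> s" "s \<le> t" for s
    proof (cases "s = q")
      case False
      with slope(1)[of c s q] that 3 c t pq zeros show ?thesis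
        by (auto simp: divide_simps split: if_splits)
    qed (use zeros in simp)
    then have "r q \<le> r t"
      using t 3 c pq by (intro DERIV_nonneg_imp_nondecreasing[of q t r]) (auto intro!: exI der)
    then show ?thesis
      using zeros by simp
  qed
qed

text \<open>The quadratic is the Hermite interpolant of \<open>h\<close> at the nodes \<open>p, q, q\<close>. In Newton form
  its linear coefficient is \<open>h[p,q] - (p + q) h[p,q,q]\<close>, which is where \<open>p + q \<le> 0\<close> enters.\<close>

lemma absolutely_monotone_quadratic_minorant:
  assumes h: "absolutely_monotone h"
    and pq: "-1 < p" "p < q" "q < 1" "p + q \<le> 0"
  obtains a b c where "0 \<le> b" "0 \<le> c"
    "a + b * p + c * p\<^sup>2 = h p" "a + b * q + c * q\<^sup>2 = h q"
    "\<And>t. p \<le> t \<Longrightarrow> t < 1 \<Longrightarrow> a + b * t + c * t\<^sup>2 \<le> h t"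
proof -
  define h1 where "h1 = deriv h"
  define h2 where "h2 = deriv h1"
  define h3 where "h3 = deriv h2"
  have d0: "(h has_real_derivative h1 t) (at t)"
    and d1: "(h1 has_real_derivative h2 t) (at t)"
    and d2: "(h2 has_real_derivative h3 t) (at t)"
    if "t \<in> {-1<..<1}" for t
    using absolutely_monotone_deriv[OF h that, of 0] absolutely_monotone_deriv[OF h that, of 1]
      absolutely_monotone_deriv[OF h that, of 2]
    by (simp_all add: h1_def h2_def h3_def numeral_2_eq_2)
  have "0 \<le> (deriv ^^ Suc j) h t" if "t \<in> {-1<..<1}" for t j
    using h that by (simp add: absolutely_monotone_def del: funpow.simps)
  from this[of _ 0] this[of _ 1] this[of _ 2]
  have nonneg: "0 \<le> h1 t" "0 \<le> h2 t" "0 \<le> h3 t" if "t \<in> {-1<..<1}" for t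
    using that by (simp_all add: h1_def h2_def h3_def numeral_2_eq_2)
  \<comment> \<open>The mean value theorem turns the divided difference \<open>h[p,q]\<close> into
    \<open>h1 s\<close>; then \<open>d\<close> is \<open>h[p,q,q]\<close>, and its sign follows from
    monotonicity of \<open>h1\<close>.\<close>
  obtain s where s: "p < s" "s < q" "h q - h p = (q - p) * h1 s"
    using MVT2[of p q h h1] d0 pq by auto
  define d where "d = (h1 q - h1 s) / (q - p)"
  have "h1 s \<le> h1 q"
    using s pq by (intro DERIV_nonneg_imp_nondecreasing[of s q h1]) (auto intro!: exI d1 nonneg)
  then have d: "0 \<le> d"
    using pq by (simp add: d_def)
  define b where "b = h1 s - d * (p + q)"
  define a where "a = h p - b * p - d * p\<^sup>2"
  have "d * (p + q) \<le> 0"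
    using d pq by (simp add: mult_nonneg_nonpos)
  moreover have "0 \<le> h1 s"
    using s pq by (intro nonneg) auto
  ultimately have b: "0 \<le> b"
    by (simp add: b_def)
  have vp: "a + b * p + d * p\<^sup>2 = h p"
    by (simp add: a_def)
  have vq: "a + b * q + d * q\<^sup>2 = h q"
    using s(3) by (simp add: a_def b_def power2_eq_square algebra_simps)
  have "d * (q - p) = h1 q - h1 s"
    using pq by (simp add: d_def)
  then have vq': "h1 q = b + 2 * d * q"
    by (simp add: b_def algebra_simps)
  have "a + b * t + d * t\<^sup>2 \<le> h t" if "p \<le> t" "t < 1" for t
  proof -
    \<comment> \<open>The derivative of the interpolation error is \<open>h1\<close> minus an affine
      function, so its second derivative is \<open>h3\<close>, which is nonnegative.\<close>
    have "convex_on {-1<..<1} (\<lambda>t. h1 t - (b + 2 * d * t))"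
    proof (rule f''_ge0_imp_convex)
      fix x :: real assume x: "x \<in> {-1<..<1}"
      show "((\<lambda>t. h1 t - (b + 2 * d * t)) has_real_derivative h2 x - 2 * d) (at x)"
        by (auto intro!: derivative_eq_intros d1 x)
      show "((\<lambda>x. h2 x - 2 * d) has_real_derivative h3 x) (at x)"
        by (auto intro!: derivative_eq_intros d2 x)
      show "0 \<le> h3 x"
        by (rule nonneg(3)[OF x])
    qed simp
    moreover have "((\<lambda>t. h t - (a + b * t + d * t\<^sup>2)) has_real_derivative
        h1 x - (b + 2 * d * x)) (at x)" if "x \<in> {-1<..<1}" for x
      by (auto intro!: derivative_eq_intros d0 that)
    ultimately have "0 \<le> h t - (a + b * t + d * t\<^sup>2)"
      using deriv_convex_imp_nonneg[of "\<lambda>t. h t - (a + b * t + d * t\<^sup>2)"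
          "\<lambda>t. h1 t - (b + 2 * d * t)" p q t] that pq vp vq vq' by simp
    then show ?thesis
      by simp
  qed
  with that b d vp vq show thesis
    by blast
qed

section \<open>Energy bounds for spherical codes\<close>

lemma energy_alt:
  assumes "finite C"
  shows "energy h C = (\<Sum>x\<in>C. \<Sum>y\<in>C - {x}. h (x \<bullet> y))"
proof -
  have "{(x, y) \<in> C \<times> C. x \<noteq> y} = (SIGMA x:C. C - {x})"
    by auto
  then show ?thesis
    using assms by (simp add: energy_def sum.Sigma)
qed

text \<open>Adding the diagonal pairs, each worth \<open>a + b + c\<close> because
  \<open>x \<bullet> x = 1\<close>, turns the energy into sums over all of
  \<open>C \<times> C\<close>, where the linear part is a squared norm.\<close>

lemma energy_quadratic:
  fixes C :: "'a::euclidean_space set"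
  assumes "spherical_code C"
  shows "energy (\<lambda>t. a + b * t + c * t\<^sup>2) C =
    a * (real (card C))\<^sup>2 + b * (norm (\<Sum>C))\<^sup>2 + c * (\<Sum>x\<in>C. \<Sum>y\<in>C. (x \<bullet> y)\<^sup>2)
      - real (card C) * (a + b + c)"
proof -
  have fin: "finite C" and "\<And>x. x \<in> C \<Longrightarrow> norm x = 1"
    using assms by (auto simp: spherical_code_def)
  then have unit: "\<And>x. x \<in> C \<Longrightarrow> x \<bullet> x = 1"
    by (simp add: dot_square_norm)
  have "energy (\<lambda>t. a + b * t + c * t\<^sup>2) C =
      (\<Sum>x\<in>C. (\<Sum>y\<in>C. a + b * (x \<bullet> y) + c * (x \<bullet> y)\<^sup>2) - (a + b + c))"
    unfolding energy_alt[OF fin] using fin unit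
    by (intro sum.cong refl) (simp add: sum_diff1)
  also have "\<dots> = a * (real (card C))\<^sup>2 + b * (\<Sum>x\<in>C. \<Sum>y\<in>C. x \<bullet> y)
      + c * (\<Sum>x\<in>C. \<Sum>y\<in>C. (x \<bullet> y)\<^sup>2) - real (card C) * (a + b + c)"
    by (simp add: sum.distrib sum_subtractf sum_distrib_left power2_eq_square algebra_simps)
  also have "(\<Sum>x\<in>C. \<Sum>y\<in>C. x \<bullet> y) = (norm (\<Sum>C))\<^sup>2"
    by (subst sum.swap) (simp add: power2_norm_eq_inner inner_sum_left inner_sum_right)
  finally show ?thesis .
qed

text \<open>The right-hand side is the squared Frobenius norm of the frame matrix \<open>M\<close>,
  whose trace is \<open>card C\<close>. Dropping the off-diagonal entries and applying
  Cauchy-Schwarz to the trace gives the bound.\<close>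

lemma frame_potential_ge:
  fixes C :: "'a::euclidean_space set"
  assumes "spherical_code C"
  shows "(real (card C))\<^sup>2 / real DIM('a) \<le> (\<Sum>x\<in>C. \<Sum>y\<in>C. (x \<bullet> y)\<^sup>2)"
proof -
  define M where "M i j = (\<Sum>x\<in>C. (x \<bullet> i) * (x \<bullet> j))" for i j
  have unit: "\<And>x. x \<in> C \<Longrightarrow> x \<bullet> x = 1"
    using assms by (auto simp: spherical_code_def dot_square_norm)
  have inner_square: "(x \<bullet> y)\<^sup>2 = (\<Sum>i\<in>Basis. \<Sum>j\<in>Basis.
      ((x \<bullet> i) * (x \<bullet> j)) * ((y \<bullet> i) * (y \<bullet> j)))" for x y :: 'a
    unfolding power2_eq_square euclidean_inner[of x y] sum_product by (simp add: mult_ac)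
  have "real (card C) = (\<Sum>x\<in>C. \<Sum>i\<in>Basis. (x \<bullet> i) * (x \<bullet> i))"
    using unit by (simp flip: euclidean_inner)
  also have "\<dots> = (\<Sum>i\<in>Basis. M i i)"
    unfolding M_def by (rule sum.swap)
  finally have "(real (card C))\<^sup>2 \<le> (\<Sum>i\<in>Basis. (M i i)\<^sup>2) * real DIM('a)"
    using sum_squared_le_sum_of_squares[of "\<lambda>i. M i i" Basis] by simp
  then have "(real (card C))\<^sup>2 / real DIM('a) \<le> (\<Sum>i\<in>Basis. (M i i)\<^sup>2)"
    by (simp add: divide_simps)
  also have "\<dots> \<le> (\<Sum>i\<in>Basis. \<Sum>j\<in>Basis. (M i j)\<^sup>2)"
    by (intro sum_mono member_le_sum) auto
  also have "\<dots> = (\<Sum>i\<in>Basis. \<Sum>j\<in>Basis. \<Sum>x\<in>C. \<Sum>y\<in>C.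
      ((x \<bullet> i) * (x \<bullet> j)) * ((y \<bullet> i) * (y \<bullet> j)))"
    by (simp add: M_def power2_eq_square sum_product)
  also have "\<dots> = (\<Sum>i\<in>Basis. \<Sum>x\<in>C. \<Sum>y\<in>C. \<Sum>j\<in>Basis.
      ((x \<bullet> i) * (x \<bullet> j)) * ((y \<bullet> i) * (y \<bullet> j)))"
    by (subst sum.swap, subst (2) sum.swap) (rule refl)
  also have "\<dots> = (\<Sum>x\<in>C. \<Sum>y\<in>C. \<Sum>i\<in>Basis. \<Sum>j\<in>Basis.
      ((x \<bullet> i) * (x \<bullet> j)) * ((y \<bullet> i) * (y \<bullet> j)))"
    by (subst sum.swap, subst (2) sum.swap) (rule refl)
  also have "\<dots> = (\<Sum>x\<in>C. \<Sum>y\<in>C. (x \<bullet> y)\<^sup>2)"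
    using inner_square by simp
  finally show ?thesis .
qed

text \<open>The bound depends on \<open>C\<close> only through its cardinality: the squared norm of
  the sum is dropped since \<open>b\<close> is nonnegative, and the frame potential is replaced by
  its minimum since \<open>c\<close> is nonnegative.\<close>

lemma energy_ge_of_quadratic_minorant:
  fixes C :: "'a::euclidean_space set"
  assumes C: "C \<in> avoiding_codes {-1..<p}" and bc: "0 \<le> b" "0 \<le> c"
    and le: "\<And>t. p \<le> t \<Longrightarrow> t < 1 \<Longrightarrow> a + b * t + c * t\<^sup>2 \<le> h t"
  shows "a * (real (card C))\<^sup>2 + c * ((real (card C))\<^sup>2 / real DIM('a))
    - real (card C) * (a + b + c) \<le> energy h C"
proof -
  have code: "spherical_code C" and fin: "finite C" and unit: "\<And>x. x \<in> C \<Longrightarrow> norm x = 1"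
    and avoid: "inner_products C \<inter> {-1..<p} = {}"
    using C by (auto simp: avoiding_codes_def spherical_code_def)
  have range: "p \<le> x \<bullet> y" "x \<bullet> y < 1" if "x \<in> C" "y \<in> C" "x \<noteq> y" for x y
  proof -
    have "\<bar>x \<bullet> y\<bar> \<le> 1"
      using Cauchy_Schwarz_ineq2[of x y] that unit by simp
    moreover have "x \<bullet> y \<in> inner_products C"
      using that by (auto simp: inner_products_def)
    ultimately show "p \<le> x \<bullet> y"
      using avoid by force
    \<comment> \<open>Equality in Cauchy-Schwarz would make the two unit vectors coincide.\<close>
    have "x \<bullet> y \<noteq> 1"
      using that unit norm_cauchy_schwarz_eq[of x y] by auto
    with \<open>\<bar>x \<bullet> y\<bar> \<le> 1\<close> show "x \<bullet> y < 1"
      by simp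
  qed
  have "a * (real (card C))\<^sup>2 + c * ((real (card C))\<^sup>2 / real DIM('a)) - real (card C) * (a + b + c)
      \<le> energy (\<lambda>t. a + b * t + c * t\<^sup>2) C"
    unfolding energy_quadratic[OF code]
    using mult_left_mono[OF frame_potential_ge[OF code] bc(2)] bc(1)
    by (smt (verit) mult_nonneg_nonneg zero_le_power2)
  also have "\<dots> \<le> energy h C"
    unfolding energy_alt[OF fin] by (intro sum_mono le range) auto
  finally show ?thesis .
qed

text \<open>\<open>D\<close> attains the bound valid for \<open>C\<close>: the minorant agrees with
  \<open>h\<close> on its inner products, its sum vanishes and its frame potential is
  minimal.\<close>

lemma energy_optimal:
  fixes C D :: "'a::euclidean_space set"
  assumes h: "absolutely_monotone h"
    and pq: "-1 < p" "p < q" "q < 1" "p + q \<le> 0"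
    and D: "spherical_code D" "inner_products D \<subseteq> {p, q}" "\<Sum>D = 0"
    and tight: "(\<Sum>x\<in>D. \<Sum>y\<in>D. (x \<bullet> y)\<^sup>2) = (real (card D))\<^sup>2 / real DIM('a)"
    and C: "C \<in> avoiding_codes {-1..<p}" "card C = card D"
  shows "energy h D \<le> energy h C"
proof -
  obtain a b c where g: "0 \<le> b" "0 \<le> c"
    "a + b * p + c * p\<^sup>2 = h p" "a + b * q + c * q\<^sup>2 = h q"
    "\<And>t. p \<le> t \<Longrightarrow> t < 1 \<Longrightarrow> a + b * t + c * t\<^sup>2 \<le> h t"
    using absolutely_monotone_quadratic_minorant[OF h pq] by metis
  have "h t = a + b * t + c * t\<^sup>2" if "t \<in> inner_products D" for t
    using that D(2) g(3,4) by auto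
  then have "energy h D = energy (\<lambda>t. a + b * t + c * t\<^sup>2) D"
    unfolding energy_def by (intro sum.cong) (auto simp: inner_products_def)
  then show ?thesis
    using energy_ge_of_quadratic_minorant[OF C(1) g(1,2,5)] D(3) tight C(2)
    by (simp add: energy_quadratic[OF D(1)])
qed

lemma energy_two_distance:
  fixes f :: "'v::finite \<Rightarrow> 'a::euclidean_space"
  assumes "inj f" "irreflp adj" "\<And>x. card {y. adj x y} = k"
    and edge: "\<And>x y. adj x y \<Longrightarrow> f x \<bullet> f y = s"
    and nonedge: "\<And>x y. x \<noteq> y \<Longrightarrow> \<not> adj x y \<Longrightarrow> f x \<bullet> f y = t"
  shows "energy h (range f) =
    real CARD('v) * real k * h s + real CARD('v) * (real CARD('v) - real k - 1) * h t"
proof -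
  have "(\<Sum>y\<in>UNIV - {x}. h (f x \<bullet> f y)) = real k * h s + (real CARD('v) - real k - 1) * h t" for x
  proof -
    \<comment> \<open>Every other vertex is charged \<open>h t\<close>, and the \<open>k\<close>
      neighbours are corrected by \<open>h s - h t\<close>.\<close>
    have "(\<Sum>y\<in>UNIV - {x}. h (f x \<bullet> f y)) =
        (\<Sum>y\<in>UNIV - {x}. h t + (if adj x y then h s - h t else 0))"
      using edge nonedge by (intro sum.cong) auto
    also have "\<dots> = real (CARD('v) - 1) * h t
        + (\<Sum>y\<in>UNIV - {x}. if adj x y then h s - h t else 0)"
      by (simp add: sum.distrib)
    also have "(\<Sum>y\<in>UNIV - {x}. if adj x y then h s - h t else 0)
        = (\<Sum>y\<in>UNIV. if adj x y then h s - h t else 0)"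
      using \<open>irreflp adj\<close> by (intro sum.mono_neutral_left) (auto simp: irreflp_def)
    also have "\<dots> = real k * (h s - h t)"
      using assms(3)[of x] by (simp add: sum.If_cases)
    finally show ?thesis
      by (simp add: of_nat_diff Suc_leI algebra_simps)
  qed
  moreover have "(\<Sum>w\<in>range f - {f x}. h (f x \<bullet> w)) = (\<Sum>y\<in>UNIV - {x}. h (f x \<bullet> f y))" for x
  proof -
    have "range f - {f x} = f ` (UNIV - {x})"
      using \<open>inj f\<close> by (auto dest: injD)
    then show ?thesis
      using \<open>inj f\<close> by (simp add: sum.reindex inj_on_subset)
  qed
  ultimately show ?thesis
    using \<open>inj f\<close>
    by (simp only: energy_alt finite_imageI finite sum.reindex o_def) (simp add: algebra_simps)
qed

section \<open>Eigenspaces of symmetric matrices with constant row sums, and projections onto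
  them\<close>

lemma mem_eigenspace_iff:
  "u \<in> eigenspace A e \<longleftrightarrow> (\<forall>x. (\<Sum>y\<in>UNIV. A $ x $ y * u $ y) = e * u $ x)"
  by (simp add: eigenspace_def vec_eq_iff matrix_vector_mult_def)

lemma subspace_eigenspace: "subspace (eigenspace A e)"
  by (auto simp: subspace_def eigenspace_def matrix_vector_right_distrib
      matrix_vector_mult_scaleR scaleR_right_distrib)

text \<open>The all-ones vector is an eigenvector for \<open>k\<close>, and eigenvectors of a
  symmetric matrix for distinct eigenvalues are orthogonal.\<close>

lemma sum_eigenvector_zero:
  fixes A :: "real ^ 'v::finite ^ 'v"
  assumes sym: "\<And>x y. A $ x $ y = A $ y $ x"
    and row_sum: "\<And>x. (\<Sum>y\<in>UNIV. A $ x $ y) = k"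
    and u: "e \<noteq> k" "u \<in> eigenspace A e"
  shows "(\<Sum>x\<in>UNIV. u $ x) = 0"
proof -
  have "e * (\<Sum>x\<in>UNIV. u $ x) = (\<Sum>x\<in>UNIV. \<Sum>y\<in>UNIV. A $ x $ y * u $ y)"
    using u by (simp add: mem_eigenspace_iff sum_distrib_left)
  also have "\<dots> = (\<Sum>y\<in>UNIV. (\<Sum>x\<in>UNIV. A $ y $ x) * u $ y)"
    by (subst sum.swap) (simp add: sum_distrib_right sym)
  also have "\<dots> = k * (\<Sum>x\<in>UNIV. u $ x)"
    by (simp add: row_sum sum_distrib_left)
  finally show ?thesis
    using u(1) by simp
qed

lemma orthogonal_projection_eqI:
  assumes "subspace S" "y \<in> S" "\<And>z. z \<in> S \<Longrightarrow> y \<bullet> z = x \<bullet> z"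
  shows "orthogonal_projection S x = y"
  unfolding orthogonal_projection_def
proof (rule the_equality)
  show "y \<in> S \<and> (\<forall>z\<in>S. orthogonal (x - y) z)"
    using assms by (simp add: orthogonal_def inner_diff_left)
next
  fix w assume w: "w \<in> S \<and> (\<forall>z\<in>S. orthogonal (x - w) z)"
  then have "w - y \<in> S"
    using assms subspace_diff by blast
  with w assms(3) have "(w - y) \<bullet> (w - y) = 0"
    by (simp add: orthogonal_def inner_diff_left)
  then show "w = y"
    by simp
qed

text \<open>The last assumption says \<open>(A - e I) (A - e' I) = c J\<close> with \<open>J\<close> the all-ones matrix.\<close>

locale quadratic_regular_matrix =
  fixes A :: "real ^ 'v::finite ^ 'v" and k e e' c :: real
  assumes sym: "A $ x $ y = A $ y $ x"
    and row_sum: "(\<Sum>y\<in>UNIV. A $ x $ y) = k"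
    and eigenvalue_neq_degree: "e \<noteq> k"
    and square: "(\<Sum>z\<in>UNIV. A $ x $ z * A $ z $ y) =
      (e + e') * A $ x $ y - (if x = y then e * e' else 0) + c"
begin

text \<open>Row \<open>x\<close> of \<open>A - e' I\<close> minus its mean entry, which removes the
  all-ones component. Up to the factor \<open>e - e'\<close>, if nonzero, this is the projection of
  the basis vector at \<open>x\<close>.\<close>

definition shifted_row :: "'v \<Rightarrow> real ^ 'v" where
  "shifted_row x = (\<chi> y. A $ x $ y - (if x = y then e' else 0) - (k - e') / real CARD('v))"

text \<open>This is the matrix identity \<open>square\<close> applied to the all-ones
  vector.\<close>

lemma degree_equation: "(k - e) * (k - e') = c * real CARD('v)"
proof -
  fix x :: 'v
  have "k * k = (\<Sum>z\<in>UNIV. A $ x $ z * (\<Sum>y\<in>UNIV. A $ z $ y))"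
    by (simp add: row_sum flip: sum_distrib_right)
  also have "\<dots> = (\<Sum>y\<in>UNIV. \<Sum>z\<in>UNIV. A $ x $ z * A $ z $ y)"
    by (subst sum.swap) (simp add: sum_distrib_left)
  also have "\<dots> = (e + e') * k - e * e' + c * real CARD('v)"
    by (simp add: square sum.distrib sum_subtractf row_sum flip: sum_distrib_left)
  finally show ?thesis
    by (simp add: algebra_simps)
qed

text \<open>By \<open>square\<close>, \<open>A - e I\<close> sends row \<open>x\<close> of
  \<open>A - e' I\<close> to the constant vector \<open>c\<close>. It sends the subtracted constant
  \<open>d\<close> to \<open>(k - e) * d\<close>, which is also \<open>c\<close> by the degree
  equation, so the two cancel.\<close>

lemma shifted_row_in_eigenspace: "shifted_row x \<in> eigenspace A e"
  unfolding mem_eigenspace_iff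
proof
  fix y
  define d where "d = (k - e') / real CARD('v)"
  have c: "c = (k - e) * d"
    using degree_equation by (simp add: field_simps d_def)
  have row: "shifted_row x $ z = A $ z $ x - (if x = z then e' else 0) - d" for z
    by (simp add: shifted_row_def d_def sym[of x])
  have "(\<Sum>z\<in>UNIV. A $ y $ z * shifted_row x $ z) =
      (\<Sum>z\<in>UNIV. A $ y $ z * A $ z $ x) - (\<Sum>z\<in>UNIV. if x = z then A $ y $ z * e' else 0)
        - (\<Sum>z\<in>UNIV. A $ y $ z) * d"
    unfolding sum_distrib_right sum_subtractf[symmetric]
    by (intro sum.cong refl) (simp add: row right_diff_distrib)
  also have "\<dots> = e * shifted_row x $ y"
    unfolding square row_sum c row by (simp add: algebra_simps)
  finally show "(\<Sum>z\<in>UNIV. A $ y $ z * shifted_row x $ z) = e * shifted_row x $ y" .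
qed

text \<open>On \<open>u\<close> the matrix \<open>A - e' I\<close> acts as \<open>e - e'\<close>,
  and the mean contributes nothing because the coordinates of \<open>u\<close> sum to 0.\<close>

lemma shifted_row_inner:
  assumes "u \<in> eigenspace A e"
  shows "shifted_row x \<bullet> u = (e - e') * u $ x"
proof -
  let ?d = "(k - e') / real CARD('v)"
  have "shifted_row x \<bullet> u = (\<Sum>y\<in>UNIV. A $ x $ y * u $ y)
      - (\<Sum>y\<in>UNIV. if x = y then e' * u $ y else 0) - ?d * (\<Sum>y\<in>UNIV. u $ y)"
    unfolding inner_vec_def sum_distrib_left sum_subtractf[symmetric]
    by (intro sum.cong refl) (simp add: shifted_row_def left_diff_distrib)
  then show ?thesis
    using assms by (simp add: sum_eigenvector_zero[OF sym row_sum eigenvalue_neq_degree] mem_eigenspace_iff left_diff_distrib)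
qed

lemma orthogonal_projection_axis:
  assumes "e \<noteq> e'"
  shows "orthogonal_projection (eigenspace A e) (axis x 1) = (1 / (e - e')) *\<^sub>R shifted_row x"
proof (rule orthogonal_projection_eqI[OF subspace_eigenspace])
  show "(1 / (e - e')) *\<^sub>R shifted_row x \<in> eigenspace A e"
    by (intro subspace_scale subspace_eigenspace shifted_row_in_eigenspace)
  show "(1 / (e - e')) *\<^sub>R shifted_row x \<bullet> u = axis x 1 \<bullet> u" if "u \<in> eigenspace A e" for u
    using shifted_row_inner[OF that, of x] assms by (simp add: inner_axis')
qed

end

text \<open>When both roots of the quadratic equation coincide, \<open>A\<close> is a combination of \<open>I\<close> and \<open>J\<close>
  (the graph is complete or empty), and then any number can serve as the second root.\<close>

lemma exists_distinct_second_root: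
  fixes A :: "real ^ 'v::finite ^ 'v"
  assumes sym: "\<And>x y. A $ x $ y = A $ y $ x"
    and row_sum: "\<And>x. (\<Sum>y\<in>UNIV. A $ x $ y) = k"
    and square: "\<And>x y. (\<Sum>z\<in>UNIV. A $ x $ z * A $ z $ y) =
      a * A $ x $ y + (if x = y then b else 0) + c"
    and e: "eigenvalue A e" "e \<noteq> k"
  obtains e' c' where "e' \<noteq> e" "quadratic_regular_matrix A k e e' c'"
proof -
  obtain u where u: "u \<noteq> 0" "u \<in> eigenspace A e"
    using e(1) by (auto simp: eigenvalue_def eigenspace_def)
  have sum_u: "(\<Sum>x\<in>UNIV. u $ x) = 0"
    by (rule sum_eigenvector_zero[OF sym row_sum e(2) u(2)])
  obtain x where x: "u $ x \<noteq> 0"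
    using u(1) by (auto simp: vec_eq_iff)
  have Au: "(\<Sum>y\<in>UNIV. A $ x $ y * u $ y) = e * u $ x" for x
    using u(2) by (simp add: mem_eigenspace_iff)
  \<comment> \<open>Applying the formula for the square of \<open>A\<close> to \<open>u\<close>
    shows that \<open>e\<close> is a root of \<open>X * X = a * X + b\<close>; the constant
    \<open>c\<close> drops out with the coordinate sum.\<close>
  have "e * e * u $ x = e * (\<Sum>z\<in>UNIV. A $ x $ z * u $ z)"
    by (simp add: Au)
  also have "\<dots> = (\<Sum>z\<in>UNIV. A $ x $ z * (e * u $ z))"
    by (simp add: sum_distrib_left mult.left_commute)
  also have "\<dots> = (\<Sum>z\<in>UNIV. A $ x $ z * (\<Sum>y\<in>UNIV. A $ z $ y * u $ y))"
    by (simp only: Au)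
  also have "\<dots> = (\<Sum>y\<in>UNIV. (\<Sum>z\<in>UNIV. A $ x $ z * A $ z $ y) * u $ y)"
    unfolding sum_distrib_left sum_distrib_right by (subst sum.swap) (simp add: mult.assoc)
  also have "\<dots> = (\<Sum>y\<in>UNIV. a * (A $ x $ y * u $ y) + (if x = y then b * u $ y else 0) + c * u $ y)"
    by (intro sum.cong refl, simp only: square) (simp add: algebra_simps)
  also have "\<dots> = (a * e + b) * u $ x"
    unfolding sum.distrib sum_distrib_left[symmetric] Au sum_u
    by (simp add: algebra_simps)
  finally have root: "e * e = a * e + b"
    using x by simp
  \<comment> \<open>By Vieta the other root is \<open>a - e\<close>.\<close>
  interpret M: quadratic_regular_matrix A k e "a - e" c
    by unfold_locales (use sym row_sum e(2) square root in \<open>auto simp: algebra_simps\<close>)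
  show thesis
  proof (cases "a - e = e")
    case False
    then show ?thesis
      using that M.quadratic_regular_matrix_axioms by blast
  next
    case True
    define d where "d = (k - e) / real CARD('v)"
    \<comment> \<open>With equal roots, \<open>shifted_row_inner\<close> applied to the row itself
      gives it squared norm 0.\<close>
    have "M.shifted_row x = 0" for x
      using M.shifted_row_inner[OF M.shifted_row_in_eigenspace, of x x] True by simp
    then have "M.shifted_row x $ y = 0" for x y
      by simp
    then have A_zero: "A $ x $ y - (if x = y then e else 0) - d = 0" for x y
      unfolding M.shifted_row_def vec_lambda_beta d_def by (simp only: True)
    have A: "A $ x $ y = (if x = y then e else 0) + d" for x y
      using A_zero[of x y] by linarith
    \<comment> \<open>Now \<open>A = e I + d J\<close>. The value \<open>e + 1\<close> is an
      arbitrary choice different from \<open>e\<close>, and the constant is what the square of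
      \<open>e I + d J\<close> then requires.\<close>
    have "quadratic_regular_matrix A k e (e + 1) (real CARD('v) * d * d - d)"
    proof
      fix x y
      have "(\<Sum>z\<in>UNIV. A $ x $ z * A $ z $ y) =
          (\<Sum>z\<in>UNIV. (if x = z then e * A $ z $ y else 0) + ((if z = y then d * e else 0) + d * d))"
        by (intro sum.cong refl) (simp add: A algebra_simps)
      also have "\<dots> = (e + (e + 1)) * A $ x $ y - (if x = y then e * (e + 1) else 0)
          + (real CARD('v) * d * d - d)"
        by (simp add: sum.distrib) (simp add: A algebra_simps)
      finally show "(\<Sum>z\<in>UNIV. A $ x $ z * A $ z $ y) = \<dots>" .
    qed (use sym row_sum e(2) in auto)
    then show ?thesis
      using that by force
  qed
qed

section \<open>Strongly regular graphs and their spectral embeddings\<close>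

text \<open>Entries of the square count common neighbours: \<open>k\<close> on the diagonal,
  \<open>l\<close> on edges, \<open>m\<close> elsewhere.\<close>

lemma strongly_regular_graph_matrix_square:
  fixes adj :: "'v::finite \<Rightarrow> 'v \<Rightarrow> bool"
  assumes "strongly_regular_graph adj v k l m"
  shows "(\<Sum>z\<in>UNIV. adjacency_matrix adj $ x $ z * adjacency_matrix adj $ z $ y) =
    (real l - real m) * adjacency_matrix adj $ x $ y + (if x = y then real k - real m else 0) + real m"
proof -
  have "(\<Sum>z\<in>UNIV. adjacency_matrix adj $ x $ z * adjacency_matrix adj $ z $ y) =
      (\<Sum>z\<in>UNIV. if adj x z \<and> adj y z then 1 else 0)"
    using assms
    by (intro sum.cong) (auto simp: adjacency_matrix_def strongly_regular_graph_def dest: sympD)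
  also have "\<dots> = real (card {z. adj x z \<and> adj y z})"
    by (simp add: sum.If_cases)
  finally show ?thesis
    using assms by (auto simp: adjacency_matrix_def strongly_regular_graph_def irreflp_def)
qed

text \<open>Polarization: inner products are determined by norms of \<open>u\<close>,
  \<open>w\<close> and \<open>u + w\<close>.\<close>

lemma inner_eq_of_norm_eq:
  fixes L :: "'a::real_inner \<Rightarrow> 'b::real_inner"
  assumes "linear L" "subspace S" "\<And>u. u \<in> S \<Longrightarrow> norm (L u) = norm u" "u \<in> S" "w \<in> S"
  shows "L u \<bullet> L w = u \<bullet> w"
  using assms by (simp add: dot_norm subspace_add flip: linear_add)

text \<open>The projections \<open>P x\<close> of the standard basis vectors are characterised by
  \<open>P x \<bullet> u = u $ x\<close>, so Parseval's identity makes the normalised vectors a tight frame.\<close>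

lemma projected_basis_frame:
  fixes P :: "'v::finite \<Rightarrow> real ^ 'v" and L :: "real ^ 'v \<Rightarrow> 'b::euclidean_space"
  assumes L: "linear L" "subspace S" "\<And>u. u \<in> S \<Longrightarrow> norm (L u) = norm u" "L ` S = UNIV"
    and P: "\<And>x. P x \<in> S" "\<And>x u. u \<in> S \<Longrightarrow> P x \<bullet> u = u $ x"
    and r: "0 < r" "\<And>x. norm (P x) = r"
  shows "L (sgn (P x)) \<bullet> L (sgn (P y)) = P x $ y / r\<^sup>2"
    and "(\<Sum>x\<in>UNIV. (L (sgn (P x)) \<bullet> z)\<^sup>2) = (norm z)\<^sup>2 / r\<^sup>2"
    and "real CARD('v) = real DIM('b) / r\<^sup>2"
proof -
  have sgn_P: "sgn (P x) \<in> S" for x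
    using P(1) L(2) by (simp add: sgn_div_norm subspace_scale)
  have inner: "L (sgn (P x)) \<bullet> L u = u $ x / r" if "u \<in> S" for x u
  proof -
    have "L (sgn (P x)) \<bullet> L u = sgn (P x) \<bullet> u"
      using inner_eq_of_norm_eq[OF L(1-3) sgn_P that] by simp
    then show ?thesis
      using that P r by (simp add: sgn_div_norm divide_inverse_commute)
  qed
  show "L (sgn (P x)) \<bullet> L (sgn (P y)) = P x $ y / r\<^sup>2"
    using inner[OF sgn_P, of y x] r
    by (simp add: inner_commute sgn_div_norm divide_inverse power2_eq_square)
  have tight: "(\<Sum>x\<in>UNIV. (L (sgn (P x)) \<bullet> z)\<^sup>2) = (norm z)\<^sup>2 / r\<^sup>2" for z
  proof -
    obtain u where u: "u \<in> S" "z = L u"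
      using L(4) by (metis UNIV_I imageE)
    then have "(norm z)\<^sup>2 = u \<bullet> u"
      using L(3) by (simp add: power2_norm_eq_inner)
    also have "\<dots> = (\<Sum>x\<in>UNIV. (u $ x)\<^sup>2)"
      by (simp add: inner_vec_def power2_eq_square)
    finally show ?thesis
      using u inner by (simp add: power_divide sum_divide_distrib)
  qed
  then show "(\<Sum>x\<in>UNIV. (L (sgn (P x)) \<bullet> z)\<^sup>2) = (norm z)\<^sup>2 / r\<^sup>2" .
  have "norm (sgn (P x)) = 1" for x
    using r(1) r(2)[of x] by (auto simp: norm_sgn)
  \<comment> \<open>Trace count: summing the squared coordinates of the unit vectors in the other
    order gives \<open>1 / r\<^sup>2\<close> per basis direction.\<close>
  then have "real CARD('v) = (\<Sum>x\<in>UNIV. (norm (L (sgn (P x))))\<^sup>2)"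
    using L(3)[OF sgn_P] by simp
  also have "\<dots> = (\<Sum>x\<in>UNIV. \<Sum>i\<in>Basis. (L (sgn (P x)) \<bullet> i)\<^sup>2)"
    unfolding power2_norm_eq_inner by (simp add: power2_eq_square flip: euclidean_inner)
  also have "\<dots> = (\<Sum>i\<in>Basis. \<Sum>x\<in>UNIV. (L (sgn (P x)) \<bullet> i)\<^sup>2)"
    by (rule sum.swap)
  also have "\<dots> = real DIM('b) / r\<^sup>2"
    by (simp add: tight)
  finally show "real CARD('v) = real DIM('b) / r\<^sup>2" .
qed

theorem theorem7p11:
  fixes adj :: "'v::finite \<Rightarrow> 'v \<Rightarrow> bool"
    and v k l m :: nat
    and e p q :: real
    and f :: "'v \<Rightarrow> real ^ 'n"
  assumes "strongly_regular_graph adj v k l m"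
    and "eigenvalue (adjacency_matrix adj) e" and "e \<noteq> real k"
    and "spectral_embedding adj e f"
    and "{f x \<bullet> f y | x y. x \<noteq> y} = {p, q}"
    and "-1 < p" "p < 0" "0 < q" "q < 1"
    and "p + q \<le> 0"
  shows "universally_optimal_in (avoiding_codes {-1..<p}) (range f) \<and>
    (\<forall>h. absolutely_monotone h \<longrightarrow>
      (if corresponds_to_edge adj f p
       then
         (\<forall>C :: (real ^ 'n) set. C \<in> avoiding_codes {-1..<p} \<and> card C = v \<longrightarrow>
            energy h C \<ge> min_energy TYPE(real ^ 'n) h v {-1..<p}) \<and>
         min_energy TYPE(real ^ 'n) h v {-1..<p}
           = real v * real k * h p + real v * (real v - real k - 1) * h q
       else
         corresponds_to_nonedge adj f p \<and>
         (\<forall>C :: (real ^ 'n) set. C \<in> avoiding_codes {-1..<p} \<and> card C = v \<longrightarrow>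
            energy h C \<ge> min_energy TYPE(real ^ 'n) h v {-1..<p}) \<and>
         min_energy TYPE(real ^ 'n) h v {-1..<p}
           = real v * (real v - real k - 1) * h p + real v * real k * h q))"
proof -
  note srg = assms(1)
  let ?A = "adjacency_matrix adj"
  let ?E = "eigenspace ?A e"
  let ?T = "{-1..<p}"
  have symm: "symp adj" and irrefl: "irreflp adj" and card_v: "CARD('v) = v"
    and degree: "\<And>x. card {y. adj x y} = k"
    using srg by (auto simp: strongly_regular_graph_def)
  have A_sym: "?A $ x $ y = ?A $ y $ x" for x y
    using symm by (auto simp: adjacency_matrix_def dest: sympD)
  have A_row_sum: "(\<Sum>y\<in>UNIV. ?A $ x $ y) = real k" for x
    using degree by (simp add: adjacency_matrix_def sum.If_cases)
  obtain e' c where e': "e' \<noteq> e" and M: "quadratic_regular_matrix ?A (real k) e e' c"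
    using exists_distinct_second_root[OF A_sym A_row_sum
        strongly_regular_graph_matrix_square[OF srg] assms(2,3)] by metis
  interpret M: quadratic_regular_matrix ?A "real k" e e' c
    by (rule M)
  define P where "P x = orthogonal_projection ?E (axis x 1)" for x
  have P_eq: "P x = (1 / (e - e')) *\<^sub>R M.shifted_row x" for x
    unfolding P_def by (intro M.orthogonal_projection_axis e'[symmetric])
  have P_in: "P x \<in> ?E" for x
    unfolding P_eq by (intro subspace_scale subspace_eigenspace M.shifted_row_in_eigenspace)
  have P_inner: "P x \<bullet> u = u $ x" if "u \<in> ?E" for x u
    using that e' by (simp add: P_eq M.shifted_row_inner)
  define d where "d = (real k - e') / real CARD('v)"
  have P_entry: "P x $ y = ((if adj x y then 1 else 0) - (if x = y then e' else 0) - d) / (e - e')"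
    for x y
    unfolding P_eq M.shifted_row_def d_def by (simp add: adjacency_matrix_def)
  have P_commute: "P x $ y = P y $ x" for x y
    using P_inner[OF P_in] by (metis inner_commute)
  obtain L :: "real ^ 'v \<Rightarrow> real ^ 'n" where L: "linear L"
    "\<And>u. u \<in> ?E \<Longrightarrow> norm (L u) = norm u" "L ` ?E = UNIV" and f: "\<And>x. f x = L (sgn (P x))"
    using assms(4) by (auto simp: spectral_embedding_def P_def)
  \<comment> \<open>The squared norm of \<open>P x\<close> is its own coordinate at
    \<open>x\<close>, which is the same for all vertices since there are no loops.\<close>
  define r where "r = sqrt ((- e' - d) / (e - e'))"
  have norm_P: "norm (P x) = r" for x
    using irrefl by (simp add: norm_eq_sqrt_inner P_inner[OF P_in] P_entry r_def irreflp_def)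
  have "p \<in> {f x \<bullet> f y | x y. x \<noteq> y}" "q \<in> {f x \<bullet> f y | x y. x \<noteq> y}"
    unfolding assms(5) by auto
  then obtain x0 y0 x1 y1 where attained: "x0 \<noteq> y0" "f x0 \<bullet> f y0 = p" "x1 \<noteq> y1" "f x1 \<bullet> f y1 = q"
    by blast
  \<comment> \<open>A zero projection would be sent to 0 by \<open>sgn\<close> and \<open>L\<close>,
    contradicting the negative inner product \<open>p\<close>.\<close>
  have "P x0 \<noteq> 0"
    using attained(2) \<open>p < 0\<close> linear_0[OF L(1)] by (auto simp: f)
  then have r: "0 < r"
    using norm_P[of x0] by (metis zero_less_norm_iff)
  note frame = projected_basis_frame[OF L(1) subspace_eigenspace L(2,3) P_in P_inner r norm_P,
      folded f]
  define s where "s = (1 - d) / (e - e') / r\<^sup>2"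
  define t where "t = - d / (e - e') / r\<^sup>2"
  have edge: "f x \<bullet> f y = s" if "adj x y" for x y
    using that irrefl by (auto simp: frame(1) P_entry s_def irreflp_def)
  have nonedge: "f x \<bullet> f y = t" if "x \<noteq> y" "\<not> adj x y" for x y
    using that by (simp add: frame(1) P_entry t_def)
  have two_distance: "f x \<bullet> f y \<in> {p, q}" if "x \<noteq> y" for x y
    using that assms(5) by blast
  have unit: "norm (f x) = 1" for x
  proof -
    have "P x \<noteq> 0"
      using norm_P[of x] r by auto
    moreover have "sgn (P x) \<in> ?E"
      unfolding sgn_div_norm by (intro subspace_scale subspace_eigenspace P_in)
    ultimately show ?thesis
      by (simp add: f L(2) norm_sgn)
  qed
  have inj: "inj f"
  proof (rule injI, rule ccontr)
    fix x y assume "f x = f y" "x \<noteq> y"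
    then have "1 \<in> {p, q}"
      using two_distance[of x y] unit[of y] by (simp add: dot_square_norm)
    then show False
      using \<open>p < 0\<close> \<open>q < 1\<close> by auto
  qed
  have card_range: "card (range f) = v"
    using inj card_v by (simp add: card_image)
  have code: "spherical_code (range f)"
    using unit by (auto simp: spherical_code_def)
  have products: "inner_products (range f) \<subseteq> {p, q}"
  proof
    fix a assume "a \<in> inner_products (range f)"
    then obtain x y where "a = f x \<bullet> f y" "f x \<noteq> f y"
      by (auto simp: inner_products_def)
    then show "a \<in> {p, q}"
      using two_distance[of x y] by auto
  qed
  have range_avoiding: "range f \<in> avoiding_codes ?T"
    using code products \<open>p < 0\<close> \<open>0 < q\<close> by (auto simp: avoiding_codes_def)
  \<comment> \<open>By symmetry of the projection matrix this is the coordinate sum of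
    \<open>P y\<close> over \<open>r\<^sup>2\<close>, and \<open>P y\<close> is orthogonal to the
    all-ones vector.\<close>
  have "(\<Sum>x\<in>UNIV. f x) \<bullet> f y = 0" for y
    using sum_eigenvector_zero[OF A_sym A_row_sum assms(3) P_in[of y]]
    by (simp add: inner_sum_left frame(1) P_commute[of _ y] flip: sum_divide_distrib)
  then have "(\<Sum>x\<in>UNIV. f x) \<bullet> (\<Sum>x\<in>UNIV. f x) = 0"
    by (simp add: inner_sum_right[of "\<Sum>x\<in>UNIV. f x"])
  then have centred: "\<Sum>(range f) = 0"
    using inj by (simp add: sum.reindex o_def)
  have "(\<Sum>x\<in>UNIV. \<Sum>y\<in>UNIV. (f x \<bullet> f y)\<^sup>2) = real CARD('v) / r\<^sup>2"
    by (subst sum.swap) (simp add: frame(2) unit)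
  also have "\<dots> = (real CARD('v))\<^sup>2 / real DIM(real ^ 'n)"
    using frame(3) r by (simp add: field_simps power2_eq_square)
  finally have tight:
    "(\<Sum>x\<in>range f. \<Sum>y\<in>range f. (x \<bullet> y)\<^sup>2) = (real (card (range f)))\<^sup>2 / real DIM(real ^ 'n)"
    using inj card_v card_range by (simp add: sum.reindex o_def)
  have optimal: "energy h (range f) \<le> energy h C"
    if "absolutely_monotone h" "C \<in> avoiding_codes ?T" "card C = v" for h and C :: "(real ^ 'n) set"
    using energy_optimal[OF that(1) _ _ _ _ code products centred tight that(2)] assms(6-10)
      card_range that(3) by simp
  \<comment> \<open>\<open>LEAST\<close> over the reals needs an attained minimum; the embedding
    attains it.\<close>
  have min: "min_energy TYPE(real ^ 'n) h v ?T = energy h (range f)" if "absolutely_monotone h" for h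
    unfolding min_energy_def
    by (rule Least_equality) (use that optimal range_avoiding card_range in auto)
  have energy: "energy h (range f) = real v * real k * h s + real v * (real v - real k - 1) * h t" for h
    using energy_two_distance[OF inj irrefl degree edge nonedge] card_v by simp
  have universal: "universally_optimal_in (avoiding_codes ?T) (range f)"
    using range_avoiding optimal card_range by (auto simp: universally_optimal_in_def)
  have "p \<in> {s, t}" "q \<in> {s, t}"
    using attained edge[of x0 y0] nonedge[of x0 y0] edge[of x1 y1] nonedge[of x1 y1] by auto
  then consider "p = s" "q = t" | "p = t" "q = s"
    using \<open>p < 0\<close> \<open>0 < q\<close> by auto
  then have "if corresponds_to_edge adj f p then p = s \<and> q = t
    else corresponds_to_nonedge adj f p \<and> p = t \<and> q = s"
  proof cases
    case 1
    then show ?thesis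
      using edge by (auto simp: corresponds_to_edge_def)
  next
    case 2
    \<comment> \<open>The pair with inner product \<open>q\<close> must be an edge. Its existence
      matters, since with no edges \<open>corresponds_to_edge\<close> would hold vacuously.\<close>
    have "adj x1 y1"
      using 2 attained nonedge[of x1 y1] \<open>p < 0\<close> \<open>0 < q\<close> by auto
    then have "\<not> corresponds_to_edge adj f p"
      using attained \<open>p < 0\<close> \<open>0 < q\<close> by (metis corresponds_to_edge_def less_asym)
    then show ?thesis
      using 2 nonedge by (auto simp: corresponds_to_nonedge_def)
  qed
  then show ?thesis
    using universal optimal min energy by (auto split: if_splits)
qed

end
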